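(* Let $(L,[\cdot,\cdot],\varepsilon)$ be a Lie color algebra and let $\zeta:L\to L$ be an even algebra endomorphism. Define $[x,y]_\zeta=\zeta([x,y])$ for $x,y\in L$. Then $(L,[\cdot,\cdot]_\zeta,\zeta,\varepsilon)$ is a Hom-Lie color algebra. Moreover, suppose that $(L',[\cdot,\cdot]',\varepsilon)$ is another Lie color algebra (with the same grading group $\Gamma$ and the same bi-character $\varepsilon$) and that $\zeta':L'\to L'$ is an even algebra endomorphism, and put $[x,y]'_{\zeta'}=\zeta'([x,y]')$. If $f:L\to L'$ is a Lie color algebra homomorphism satisfying $f\circ\zeta=\zeta'\circ f$, then $f:(L,[\cdot,\cdot]_\zeta,\zeta,\varepsilon)\to(L',[\cdot,\cdot]'_{\zeta'},\zeta',\varepsilon)$ is also a homomorphism of Hom-Lie color algebras.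
   Context: Throughout, $\mathbb{F}$ is a field of characteristic zero, $\Gamma$ is an abelian group (written additively), and all vector spaces are over $\mathbb{F}$. A $\Gamma$-graded vector space is $V=\bigoplus_{\alpha\in\Gamma}V_\alpha$; $\bar x\in\Gamma$ denotes the degree of a homogeneous element $x$. A linear map $f:V\to W$ of graded spaces is even if $f(V_\alpha)\subseteq W_\alpha$ for all $\alpha$; a bilinear product on $V$ is even if it maps $V_\alpha\times V_\beta$ into $V_{\alpha+\beta}$. A bi-character on $\Gamma$ is a map $\varepsilon:\Gamma\times\Gamma\to\mathbb{F}^*$ with $\varepsilon(\alpha,\beta)\varepsilon(\beta,\alpha)=1$, $\varepsilon(\alpha,\beta+\gamma)=\varepsilon(\alpha,\beta)\varepsilon(\alpha,\gamma)$, $\varepsilon(\alpha+\beta,\gamma)=\varepsilon(\alpha,\gamma)\varepsilon(\beta,\gamma)$. For homogeneous $x,y$ write $\varepsilon(x,y)=\varepsilon(\bar x,\bar y)$. The symbol $\circlearrowleft_{x,y,z}$ denotes summation over the cyclic permutations of $x,y,z$. A Lie color algebra $(L,[\cdot,\cdot],\varepsilon)$ is a $\Gamma$-graded space $L$ with an even bilinear bracket and a bi-character $\varepsilon$ such that, for all homogeneous $x,y,z$, $[x,y]=-\varepsilon(x,y)[y,x]$ and $\circlearrowleft_{x,y,z}\varepsilon(z,x)[x,[y,z]]=0$. A Lie color algebra homomorphism is an even linear map $f$ with $f([x,y])=[f(x),f(y)]'$. A Hom-Lie color algebra $(L,[\cdot,\cdot],\zeta,\varepsilon)$ consists of a $\Gamma$-graded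 space $L$, an even bilinear map $[\cdot,\cdot]:L\times L\to L$, an (even) algebra homomorphism $\zeta:L\to L$ (i.e. $\zeta([x,y])=[\zeta(x),\zeta(y)]$), and a bi-character $\varepsilon$ on $\Gamma$, such that for all homogeneous $x,y,z\in L$: $[x,y]=-\varepsilon(x,y)[y,x]$ and $\circlearrowleft_{x,y,z}\varepsilon(z,x)[\zeta(x),[y,z]]=0$. A homomorphism of Hom-Lie color algebras $f:(L,[\cdot,\cdot],\zeta,\varepsilon)\to(L',[\cdot,\cdot]',\zeta',\varepsilon)$ is a homomorphism of graded algebras (even linear, preserving brackets) with $f\circ\zeta=\zeta'\circ f$. *)

theory Defs
  imports Complex_Main
begin

text \<open>
  The underlying space of a graded space is a whole type; the grading is the family of
  its homogeneous components \<open>V \<alpha>\<close>. The ground field has characteristic zero by the sort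
  \<open>field_char_0\<close>. Being homogeneous of degree \<open>\<alpha>\<close> is rendered as membership in \<open>V \<alpha>\<close>, so
  zero counts as homogeneous of every degree.
\<close>

locale graded_vector_space = vector_space scale
  for scale :: "'k::field_char_0 \<Rightarrow> 'v::ab_group_add \<Rightarrow> 'v" +
  fixes V :: "'g::ab_group_add \<Rightarrow> 'v set"
  assumes component_subspace: "subspace (V \<alpha>)"
    and direct_sum:
      "\<exists>!c. (\<forall>\<alpha>. c \<alpha> \<in> V \<alpha>) \<and> finite {\<alpha>. c \<alpha> \<noteq> 0} \<and> x = (\<Sum>\<alpha> | c \<alpha> \<noteq> 0. c \<alpha>)"

locale graded_algebra = graded_vector_space scale V
  for scale :: "'k::field_char_0 \<Rightarrow> 'v::ab_group_add \<Rightarrow> 'v"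
    and V :: "'g::ab_group_add \<Rightarrow> 'v set" +
  fixes bracket :: "'v \<Rightarrow> 'v \<Rightarrow> 'v"
  assumes bracket_linear_left: "Vector_Spaces.linear scale scale (\<lambda>x. bracket x y)"
    and bracket_linear_right: "Vector_Spaces.linear scale scale (\<lambda>y. bracket x y)"
    and bracket_even: "x \<in> V \<alpha> \<Longrightarrow> y \<in> V \<beta> \<Longrightarrow> bracket x y \<in> V (\<alpha> + \<beta>)"

locale bicharacter =
  fixes \<epsilon> :: "'g::ab_group_add \<Rightarrow> 'g \<Rightarrow> 'k::field_char_0"
  assumes nonzero: "\<epsilon> \<alpha> \<beta> \<noteq> 0"
    and skew: "\<epsilon> \<alpha> \<beta> * \<epsilon> \<beta> \<alpha> = 1"
    and add_right: "\<epsilon> \<alpha> (\<beta> + \<gamma>) = \<epsilon> \<alpha> \<beta> * \<epsilon> \<alpha> \<gamma>"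
    and add_left: "\<epsilon> (\<alpha> + \<beta>) \<gamma> = \<epsilon> \<alpha> \<gamma> * \<epsilon> \<beta> \<gamma>"

locale lie_color_algebra = graded_algebra scale V bracket + bicharacter \<epsilon>
  for scale :: "'k::field_char_0 \<Rightarrow> 'v::ab_group_add \<Rightarrow> 'v"
    and V :: "'g::ab_group_add \<Rightarrow> 'v set"
    and bracket :: "'v \<Rightarrow> 'v \<Rightarrow> 'v"
    and \<epsilon> :: "'g \<Rightarrow> 'g \<Rightarrow> 'k" +
  assumes color_skew_symmetry:
      "x \<in> V \<alpha> \<Longrightarrow> y \<in> V \<beta> \<Longrightarrow> bracket x y = - scale (\<epsilon> \<alpha> \<beta>) (bracket y x)"
    and color_jacobi:
      "x \<in> V \<alpha> \<Longrightarrow> y \<in> V \<beta> \<Longrightarrow> z \<in> V \<gamma> \<Longrightarrow>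
        scale (\<epsilon> \<gamma> \<alpha>) (bracket x (bracket y z)) +
        scale (\<epsilon> \<alpha> \<beta>) (bracket y (bracket z x)) +
        scale (\<epsilon> \<beta> \<gamma>) (bracket z (bracket x y)) = 0"

locale graded_algebra_hom =
  source: graded_algebra scale V bracket + target: graded_algebra scale' V' bracket'
  for scale :: "'k::field_char_0 \<Rightarrow> 'v::ab_group_add \<Rightarrow> 'v"
    and V :: "'g::ab_group_add \<Rightarrow> 'v set"
    and bracket :: "'v \<Rightarrow> 'v \<Rightarrow> 'v"
    and scale' :: "'k \<Rightarrow> 'w::ab_group_add \<Rightarrow> 'w"
    and V' :: "'g \<Rightarrow> 'w set"
    and bracket' :: "'w \<Rightarrow> 'w \<Rightarrow> 'w" +
  fixes f :: "'v \<Rightarrow> 'w"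
  assumes hom_linear: "Vector_Spaces.linear scale scale' f"
    and hom_even: "f ` V \<alpha> \<subseteq> V' \<alpha>"
    and hom_bracket: "f (bracket x y) = bracket' (f x) (f y)"

locale lie_color_algebra_hom =
  source: lie_color_algebra scale V bracket \<epsilon> +
  target: lie_color_algebra scale' V' bracket' \<epsilon> +
  graded_algebra_hom scale V bracket scale' V' bracket' f
  for scale :: "'k::field_char_0 \<Rightarrow> 'v::ab_group_add \<Rightarrow> 'v"
    and V :: "'g::ab_group_add \<Rightarrow> 'v set"
    and bracket :: "'v \<Rightarrow> 'v \<Rightarrow> 'v"
    and scale' :: "'k \<Rightarrow> 'w::ab_group_add \<Rightarrow> 'w"
    and V' :: "'g \<Rightarrow> 'w set"
    and bracket' :: "'w \<Rightarrow> 'w \<Rightarrow> 'w"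
    and \<epsilon> :: "'g \<Rightarrow> 'g \<Rightarrow> 'k"
    and f :: "'v \<Rightarrow> 'w"

locale hom_lie_color_algebra =
  graded_algebra scale V bracket +
  twist: graded_algebra_hom scale V bracket scale V bracket \<zeta> +
  bicharacter \<epsilon>
  for scale :: "'k::field_char_0 \<Rightarrow> 'v::ab_group_add \<Rightarrow> 'v"
    and V :: "'g::ab_group_add \<Rightarrow> 'v set"
    and bracket :: "'v \<Rightarrow> 'v \<Rightarrow> 'v"
    and \<zeta> :: "'v \<Rightarrow> 'v"
    and \<epsilon> :: "'g \<Rightarrow> 'g \<Rightarrow> 'k" +
  assumes color_skew_symmetry:
      "x \<in> V \<alpha> \<Longrightarrow> y \<in> V \<beta> \<Longrightarrow> bracket x y = - scale (\<epsilon> \<alpha> \<beta>) (bracket y x)"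
    and hom_color_jacobi:
      "x \<in> V \<alpha> \<Longrightarrow> y \<in> V \<beta> \<Longrightarrow> z \<in> V \<gamma> \<Longrightarrow>
        scale (\<epsilon> \<gamma> \<alpha>) (bracket (\<zeta> x) (bracket y z)) +
        scale (\<epsilon> \<alpha> \<beta>) (bracket (\<zeta> y) (bracket z x)) +
        scale (\<epsilon> \<beta> \<gamma>) (bracket (\<zeta> z) (bracket x y)) = 0"

locale hom_lie_color_algebra_hom =
  source: hom_lie_color_algebra scale V bracket \<zeta> \<epsilon> +
  target: hom_lie_color_algebra scale' V' bracket' \<zeta>' \<epsilon> +
  graded_algebra_hom scale V bracket scale' V' bracket' f
  for scale :: "'k::field_char_0 \<Rightarrow> 'v::ab_group_add \<Rightarrow> 'v"
    and V :: "'g::ab_group_add \<Rightarrow> 'v set"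
    and bracket :: "'v \<Rightarrow> 'v \<Rightarrow> 'v"
    and \<zeta> :: "'v \<Rightarrow> 'v"
    and scale' :: "'k \<Rightarrow> 'w::ab_group_add \<Rightarrow> 'w"
    and V' :: "'g \<Rightarrow> 'w set"
    and bracket' :: "'w \<Rightarrow> 'w \<Rightarrow> 'w"
    and \<zeta>' :: "'w \<Rightarrow> 'w"
    and \<epsilon> :: "'g \<Rightarrow> 'g \<Rightarrow> 'k"
    and f :: "'v \<Rightarrow> 'w" +
  assumes hom_twist: "f \<circ> \<zeta> = \<zeta>' \<circ> f"

definition twisted_bracket :: "('v \<Rightarrow> 'v) \<Rightarrow> ('v \<Rightarrow> 'v \<Rightarrow> 'v) \<Rightarrow> 'v \<Rightarrow> 'v \<Rightarrow> 'v"
  where "twisted_bracket \<zeta> bracket x y = \<zeta> (bracket x y)"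

end

theory Submission
  imports Defs
begin

text \<open>Since \<open>\<zeta>\<close> is multiplicative for the original bracket, a nested
  twisted bracket whose outer left argument is \<open>\<zeta> x\<close> equals
  \<open>\<zeta> (\<zeta> (bracket x (bracket y z)))\<close>. The Hom-Jacobi sum is therefore the
  image under the linear map \<open>\<zeta> \<circ> \<zeta>\<close> of the color Jacobi sum, hence
  zero, and the twisted skew-symmetry is the image under \<open>\<zeta>\<close> of the original one;
  this is \<open>hom_lie_color_algebra_twisted_bracket\<close>. For morphisms, \<open>f\<close>
  carries \<open>\<zeta> (bracket x y)\<close> to \<open>\<zeta>' (f (bracket x y))\<close>, which
  is the twisted bracket of \<open>f x\<close> and \<open>f y\<close>; this is
  \<open>graded_algebra_hom_twisted_bracket\<close>.\<close>

text \<open>Composing an even bilinear product with an even linear map preserves bilinearity and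
  degrees.\<close>

lemma graded_algebra_twisted_bracket:
  assumes "graded_algebra_hom scale V bracket scale V bracket \<zeta>"
  shows "graded_algebra scale V (twisted_bracket \<zeta> bracket)"
proof -
  interpret \<zeta>: graded_algebra_hom scale V bracket scale V bracket \<zeta> by fact
  show ?thesis
  proof (intro graded_algebra.intro graded_algebra_axioms.intro)
    show "graded_vector_space scale V" by (rule \<zeta>.source.graded_vector_space_axioms)
    show "Vector_Spaces.linear scale scale (\<lambda>x. twisted_bracket \<zeta> bracket x y)" for y
      using Vector_Spaces.linear_compose[OF \<zeta>.source.bracket_linear_left \<zeta>.hom_linear]
      by (simp add: twisted_bracket_def o_def)
    show "Vector_Spaces.linear scale scale (\<lambda>y. twisted_bracket \<zeta> bracket x y)" for x
      using Vector_Spaces.linear_compose[OF \<zeta>.source.bracket_linear_right \<zeta>.hom_linear]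
      by (simp add: twisted_bracket_def o_def)
    show "twisted_bracket \<zeta> bracket x y \<in> V (\<alpha> + \<beta>)"
      if "x \<in> V \<alpha>" "y \<in> V \<beta>" for x y \<alpha> \<beta>
      unfolding twisted_bracket_def using \<zeta>.hom_even \<zeta>.source.bracket_even[OF that] by blast
  qed
qed

text \<open>Serves twice: with \<open>f\<close> equal to \<open>\<zeta>\<close> it makes the twist
  an endomorphism for its own twisted bracket, and with a general \<open>f\<close> it gives the
  claim about morphisms.\<close>

lemma graded_algebra_hom_twisted_bracket:
  assumes "graded_algebra_hom scale V bracket scale V bracket \<zeta>"
    and "graded_algebra_hom scale' V' bracket' scale' V' bracket' \<zeta>'"
    and "graded_algebra_hom scale V bracket scale' V' bracket' f"
    and commute: "f \<circ> \<zeta> = \<zeta>' \<circ> f"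
  shows "graded_algebra_hom scale V (twisted_bracket \<zeta> bracket)
    scale' V' (twisted_bracket \<zeta>' bracket') f"
proof -
  interpret f: graded_algebra_hom scale V bracket scale' V' bracket' f by fact
  interpret source: graded_algebra scale V "twisted_bracket \<zeta> bracket"
    by (rule graded_algebra_twisted_bracket) fact
  interpret target: graded_algebra scale' V' "twisted_bracket \<zeta>' bracket'"
    by (rule graded_algebra_twisted_bracket) fact
  show ?thesis
  proof (intro graded_algebra_hom.intro graded_algebra_hom_axioms.intro
      source.graded_algebra_axioms target.graded_algebra_axioms)
    show "Vector_Spaces.linear scale scale' f" by (rule f.hom_linear)
    show "f ` V \<alpha> \<subseteq> V' \<alpha>" for \<alpha> by (rule f.hom_even)
    show "f (twisted_bracket \<zeta> bracket x y) = twisted_bracket \<zeta>' bracket' (f x) (f y)" for x y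
      \<comment> \<open>Commutation is needed at the point \<open>bracket x y\<close>: it moves
        \<open>f\<close> inside the twist, where \<open>f\<close> preserves the untwisted
        bracket.\<close>
      using fun_cong[OF commute, of "bracket x y"] by (simp add: twisted_bracket_def f.hom_bracket)
  qed
qed

lemma hom_lie_color_algebra_twisted_bracket:
  assumes "lie_color_algebra scale V bracket \<epsilon>"
    and hom: "graded_algebra_hom scale V bracket scale V bracket \<zeta>"
  shows "hom_lie_color_algebra scale V (twisted_bracket \<zeta> bracket) \<zeta> \<epsilon>"
proof -
  interpret lie_color_algebra scale V bracket \<epsilon> by fact
  interpret \<zeta>: graded_algebra_hom scale V bracket scale V bracket \<zeta> by fact
  interpret lin: Vector_Spaces.linear scale scale \<zeta> by (rule \<zeta>.hom_linear)
  interpret twisted: graded_algebra_hom scale V "twisted_bracket \<zeta> bracket"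
      scale V "twisted_bracket \<zeta> bracket" \<zeta>
    \<comment> \<open>Source, target and map all come from \<open>\<zeta>\<close>, so the
      commutation condition reads
      \<open>\<zeta> \<circ> \<zeta> = \<zeta> \<circ> \<zeta>\<close>.\<close>
    using hom hom hom refl by (rule graded_algebra_hom_twisted_bracket)
  show ?thesis
  proof unfold_locales
    fix x y z \<alpha> \<beta> \<gamma>
    assume x: "x \<in> V \<alpha>" and y: "y \<in> V \<beta>"
    show "twisted_bracket \<zeta> bracket x y =
        - scale (\<epsilon> \<alpha> \<beta>) (twisted_bracket \<zeta> bracket y x)"
      by (simp add: twisted_bracket_def color_skew_symmetry[OF x y] lin.neg lin.scale)
    assume z: "z \<in> V \<gamma>"
    \<comment> \<open>One \<open>\<zeta>\<close> comes from the outer twisted bracket; the other is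
      shared by both arguments of the bracket inside it and can be pulled out by
      multiplicativity.\<close>
    have square: "twisted_bracket \<zeta> bracket (\<zeta> u) (twisted_bracket \<zeta> bracket v w) =
        \<zeta> (\<zeta> (bracket u (bracket v w)))" for u v w
      by (simp add: twisted_bracket_def \<zeta>.hom_bracket)
    show "scale (\<epsilon> \<gamma> \<alpha>) (twisted_bracket \<zeta> bracket (\<zeta> x) (twisted_bracket \<zeta> bracket y z)) +
        scale (\<epsilon> \<alpha> \<beta>) (twisted_bracket \<zeta> bracket (\<zeta> y) (twisted_bracket \<zeta> bracket z x)) +
        scale (\<epsilon> \<beta> \<gamma>) (twisted_bracket \<zeta> bracket (\<zeta> z) (twisted_bracket \<zeta> bracket x y)) = 0"
      \<comment> \<open>Apply \<open>\<zeta>\<close> twice to the color Jacobi identity; linearity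
        distributes it over the three scaled terms.\<close>
      using arg_cong[OF color_jacobi[OF x y z], of "\<lambda>v. \<zeta> (\<zeta> v)"]
      by (simp add: square lin.add lin.scale lin.zero)
  qed
qed

theorem theorem3p14:
  fixes scale :: "'k::field_char_0 \<Rightarrow> 'v::ab_group_add \<Rightarrow> 'v"
    and L :: "'g::ab_group_add \<Rightarrow> 'v set"
    and bracket :: "'v \<Rightarrow> 'v \<Rightarrow> 'v"
    and \<epsilon> :: "'g \<Rightarrow> 'g \<Rightarrow> 'k"
    and \<zeta> :: "'v \<Rightarrow> 'v"
  assumes "lie_color_algebra scale L bracket \<epsilon>"
    and "graded_algebra_hom scale L bracket scale L bracket \<zeta>"
  shows "hom_lie_color_algebra scale L (twisted_bracket \<zeta> bracket) \<zeta> \<epsilon> \<and>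
    (\<forall>(scale' :: 'k \<Rightarrow> 'w::ab_group_add \<Rightarrow> 'w) (L' :: 'g \<Rightarrow> 'w set)
        (bracket' :: 'w \<Rightarrow> 'w \<Rightarrow> 'w) (\<zeta>' :: 'w \<Rightarrow> 'w) (f :: 'v \<Rightarrow> 'w).
      lie_color_algebra scale' L' bracket' \<epsilon> \<longrightarrow>
      graded_algebra_hom scale' L' bracket' scale' L' bracket' \<zeta>' \<longrightarrow>
      lie_color_algebra_hom scale L bracket scale' L' bracket' \<epsilon> f \<longrightarrow>
      f \<circ> \<zeta> = \<zeta>' \<circ> f \<longrightarrow>
      hom_lie_color_algebra_hom scale L (twisted_bracket \<zeta> bracket) \<zeta>
        scale' L' (twisted_bracket \<zeta>' bracket') \<zeta>' \<epsilon> f)"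
proof (intro conjI allI impI)
  show source: "hom_lie_color_algebra scale L (twisted_bracket \<zeta> bracket) \<zeta> \<epsilon>"
    using assms by (rule hom_lie_color_algebra_twisted_bracket)
  fix scale' :: "'k \<Rightarrow> 'w \<Rightarrow> 'w" and L' :: "'g \<Rightarrow> 'w set"
    and bracket' :: "'w \<Rightarrow> 'w \<Rightarrow> 'w" and \<zeta>' :: "'w \<Rightarrow> 'w" and f :: "'v \<Rightarrow> 'w"
  assume lie': "lie_color_algebra scale' L' bracket' \<epsilon>"
    and hom': "graded_algebra_hom scale' L' bracket' scale' L' bracket' \<zeta>'"
    and f: "lie_color_algebra_hom scale L bracket scale' L' bracket' \<epsilon> f"
    and commute: "f \<circ> \<zeta> = \<zeta>' \<circ> f"
  have "graded_algebra_hom scale L (twisted_bracket \<zeta> bracket)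
      scale' L' (twisted_bracket \<zeta>' bracket') f"
    using assms(2) hom' lie_color_algebra_hom.axioms(3)[OF f] commute
    by (rule graded_algebra_hom_twisted_bracket)
  \<comment> \<open>The target is a Hom-Lie color algebra by the same construction applied to
    \<open>L'\<close> and \<open>\<zeta>'\<close>.\<close>
  with source hom_lie_color_algebra_twisted_bracket[OF lie' hom']
  show "hom_lie_color_algebra_hom scale L (twisted_bracket \<zeta> bracket) \<zeta>
      scale' L' (twisted_bracket \<zeta>' bracket') \<zeta>' \<epsilon> f"
    using commute
    by (intro hom_lie_color_algebra_hom.intro hom_lie_color_algebra_hom_axioms.intro)
qed

end
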